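(* Let $(F,\le)$ be an ordered field and $n$ a positive integer. The operation $\square$ on $M_n(F)$ defined by $A\,\square\,B:=\Vert A\Vert_\infty\Vert B\Vert_\infty I_n$ has the following properties. (1) It is associative and commutative. (2) If $A\succeq_n B$ for some $A,B\in M_n(F)$, then $A\,\square\,C\succeq_n B\,\square\,C$ for every $C\in M_{\ast,n}(F)$. In particular, $\sim_n$ is a congruence relation on $(M_n(F),\square)$. (3) $v_n$ is surmultiplicative, i.e. $v_n(AB)\succeq_n v_n(A)\,\square\,v_n(B):=v_n(A\,\square\,B)$ for every $A\in M_n(F)$ and every $B\in M_n(F)$. (4) $\phi$ is multiplicative, i.e. $\phi(v_n(A)\,\square\,v_n(B))=\phi(v_n(A))\,\phi(v_n(B))$ for every $A,B\in M_n(F)$. (5) $\wedge_n$ is distributive over $\square$, i.e. $(v_n(A)\wedge_n v_n(B))\,\square\,v_n(C)=(v_n(A)\,\square\,v_n(C))\wedge_n(v_n(B)\,\square\,v_n(C))$ for every $A,B,C\in M_n(F)$. (6) $\vee_n$ is not distributive over $\square$, i.e. it is not true that $(v_n(A)\vee_n v_n(B))\,\square\,v_n(C)=(v_n(A)\,\square\,v_n(C))\vee_n(v_n(B)\,\square\,v_n(C))$ for every $A,B,C\in M_n(F)$.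
   Context: $I_n$ is the $n\times n$ identity matrix, $\Vert A\Vert_\infty=\max_{i,j}|a_{ij}|$ for $A=[a_{ij}]$, and $M_{\ast,n}(F)=\bigcup_{m\ge1}M_{m,n}(F)$ is the set of all matrices over $F$ with $n$ columns; the formula for $\square$ is also used when an argument lies in $M_{\ast,n}(F)$. For symmetric $S,T\in M_n(F)$ write $S\le_n T$ iff $T-S$ is positive semidefinite, i.e. $v^T(T-S)v\ge0$ for all $v\in F^n$. For $A,B\in M_{\ast,n}(F)$ write $A\succeq_n B$ iff there is $r\in\mathbb N$ with $A^TA\le_n rB^TB$, and $A\sim_n B$ iff $A\succeq_n B$ and $B\succeq_n A$; $v_n(A)$ denotes the $\sim_n$-class of $A$, and classes are partially ordered by $v_n(A)\succeq_n v_n(B)$ iff $A\succeq_n B$ (meaning $v_n(A)$ is greater than or equal to $v_n(B)$). The poset $M_n(F)/\!\sim_n$ is canonically isomorphic to $M_{\ast,n}(F)/\!\sim_n$ and is a lattice; $\wedge_n$ and $\vee_n$ denote greatest lower bound and least upper bound in it. Explicitly, $v_n(A)\wedge_n v_n(B)=v_n\left(\begin{bmatrix}A\\ B\end{bmatrix}\right)$. The operation induced by $\square$ on classes is $v_n(A)\,\square\,v_n(B):=v_n(A\,\square\,B)$. Natural valuation of $F$: for $a,b\in F$ write $a\sim b$ iff there is $r\in\mathbb N$ with $|a|\le r|b|$ and $|b|\le r|a|$; $v_F(a)=[a]$ is the class of $a$. The classes form a commutative semigroup under the operation $[a][b]:=[ab]$. The map $\phi\colon M_n(F)/\!\sim_n\to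 F/\!\sim$ is the well-defined map $\phi(v_n(A))=v_F(\Vert A\Vert_\infty)$.
   Formalization: Item (6) is stated only for n ≥ 2: for n = 1 it is false as printed, because the classes of M_1(F) are then totally ordered and □ is monotone, so ∨_1 does distribute over □. Items (1)–(5) are stated for every positive integer n. *)

theory Defs
  imports "Jordan_Normal_Form.Matrix" "HOL-Algebra.Lattice"
begin

text \<open>An ordered field is a type of class \<^class>\<open>linordered_field\<close>; matrices carry their
  dimensions explicitly, so \<open>M\<^sub>m\<^sub>,\<^sub>n(F)\<close> is \<open>carrier_mat m n\<close>.\<close>

definition mats_cols :: "nat \<Rightarrow> 'a mat set" where
  "mats_cols n = (\<Union>m\<in>{1..}. carrier_mat m n)"

text \<open>Meaningful for matrices with at least one entry.\<close>

definition max_norm :: "'a::linordered_field mat \<Rightarrow> 'a" where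
  "max_norm A = Max (abs ` elements_mat A)"

definition square_op :: "'a::linordered_field mat \<Rightarrow> nat \<Rightarrow> 'a mat \<Rightarrow> 'a mat"
  (\<open>_ \<box>\<^bsub>_\<^esub> _\<close> [71, 0, 71] 70) where
  "A \<box>\<^bsub>n\<^esub> B = (max_norm A * max_norm B) \<cdot>\<^sub>m 1\<^sub>m n"

text \<open>Positive semidefiniteness of \<open>T - S\<close>; used for symmetric \<open>S\<close> and \<open>T\<close> only.\<close>

definition loewner_le :: "nat \<Rightarrow> 'a::linordered_field mat \<Rightarrow> 'a mat \<Rightarrow> bool" where
  "loewner_le n S T \<longleftrightarrow> (\<forall>v\<in>carrier_vec n. 0 \<le> v \<bullet> ((T - S) *\<^sub>v v))"

definition dominates :: "'a::linordered_field mat \<Rightarrow> nat \<Rightarrow> 'a mat \<Rightarrow> bool"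
  (\<open>_ \<succeq>\<^bsub>_\<^esub> _\<close> [51, 0, 51] 50) where
  "A \<succeq>\<^bsub>n\<^esub> B \<longleftrightarrow>
     (\<exists>r::nat. loewner_le n (transpose_mat A * A) (of_nat r \<cdot>\<^sub>m (transpose_mat B * B)))"

definition mat_sim :: "'a::linordered_field mat \<Rightarrow> nat \<Rightarrow> 'a mat \<Rightarrow> bool"
  (\<open>_ \<sim>\<^bsub>_\<^esub> _\<close> [51, 0, 51] 50) where
  "A \<sim>\<^bsub>n\<^esub> B \<longleftrightarrow> A \<succeq>\<^bsub>n\<^esub> B \<and> B \<succeq>\<^bsub>n\<^esub> A"

definition sim_rel :: "nat \<Rightarrow> 'a::linordered_field mat rel" where
  "sim_rel n = {(A, B). A \<in> carrier_mat n n \<and> B \<in> carrier_mat n n \<and> A \<sim>\<^bsub>n\<^esub> B}"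

definition v_class :: "nat \<Rightarrow> 'a::linordered_field mat \<Rightarrow> 'a mat set" where
  "v_class n A = sim_rel n `` {A}"

text \<open>The poset \<open>M\<^sub>n(F)/\<sim>\<^sub>n\<close>. Note the orientation: \<open>v\<^sub>n(B)\<close> is below \<open>v\<^sub>n(A)\<close> iff
  \<open>A \<succeq>\<^sub>n B\<close>, so the smaller Gram matrix has the larger class and \<open>v\<^sub>n(0)\<close> is the top
  element. Greatest lower and least upper bounds are the library's \<open>\<sqinter>\<close> and \<open>\<squnion>\<close> of
  this order.\<close>

definition v_poset :: "nat \<Rightarrow> 'a::linordered_field mat set gorder" where
  "v_poset n = \<lparr>carrier = carrier_mat n n // sim_rel n, eq = (=),
     le = (\<lambda>X Y. \<exists>B\<in>X. \<exists>A\<in>Y. A \<succeq>\<^bsub>n\<^esub> B)\<rparr>"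

text \<open>Operations on classes are lifted by taking the union over all representatives, as usual
  for quotients by a congruence.\<close>

definition v_square_op :: "'a::linordered_field mat set \<Rightarrow> nat \<Rightarrow> 'a mat set \<Rightarrow> 'a mat set"
  (\<open>_ \<box>\<^sub>v\<^bsub>_\<^esub> _\<close> [71, 0, 71] 70) where
  "X \<box>\<^sub>v\<^bsub>n\<^esub> Y = (\<Union>A\<in>X. \<Union>B\<in>Y. v_class n (A \<box>\<^bsub>n\<^esub> B))"

definition field_val :: "'a::linordered_field \<Rightarrow> 'a set" where
  "field_val a = {b. \<exists>r::nat. \<bar>a\<bar> \<le> of_nat r * \<bar>b\<bar> \<and> \<bar>b\<bar> \<le> of_nat r * \<bar>a\<bar>}"

definition field_val_mult :: "'a::linordered_field set \<Rightarrow> 'a set \<Rightarrow> 'a set"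
  (infixl \<open>\<cdot>\<^sub>F\<close> 70) where
  "x \<cdot>\<^sub>F y = (\<Union>a\<in>x. \<Union>b\<in>y. field_val (a * b))"

definition phi :: "'a::linordered_field mat set \<Rightarrow> 'a set" where
  "phi X = (\<Union>A\<in>X. field_val (max_norm A))"

end

theory Submission
  imports Defs "Jordan_Normal_Form.Determinant"
begin

text \<open>
  Write \<open>q\<^sub>A(v) = (A v) \<bullet> (A v)\<close> for the quadratic form of the Gram matrix of \<open>A\<close>. Domination
  \<open>A \<succeq>\<^sub>n B\<close> says that \<open>q\<^sub>A \<le> r q\<^sub>B\<close> for some natural \<open>r\<close>. Evaluating at unit vectors gives
  \<open>\<parallel>A\<parallel> \<le> r' \<parallel>B\<parallel>\<close> for the maximum norms (\<open>dominates_imp_max_norm_le\<close>), and a crude form of the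
  Cauchy--Schwarz inequality gives \<open>q\<^sub>A(v) \<le> m n \<parallel>A\<parallel>\<^sup>2 (v \<bullet> v)\<close> for an \<open>m \<times> n\<close> matrix
  (\<open>gram_form_le_max_norm\<close>). Since \<open>A \<box> B\<close> is a scalar matrix whose scalar is
  \<open>\<parallel>A\<parallel> \<parallel>B\<parallel>\<close>, the first bound yields monotonicity of \<open>\<box>\<close>, the congruence property and the
  multiplicativity of \<open>\<phi>\<close>; the second, applied twice, yields surmultiplicativity.

  The lower bound of \<open>v\<^sub>n(A)\<close> and \<open>v\<^sub>n(B)\<close> is represented by \<open>A\<close> stacked on \<open>B\<close>, which has too many
  rows to be an element of \<open>M\<^sub>n(F)\<close>. It can be shortened without square roots: of any \<open>n + 1\<close> rows,
  the one with the largest coefficient in a linear dependence is a combination of the others with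
  coefficients of absolute value at most \<open>1\<close>, so dropping it changes \<open>q\<close> by at most a natural factor
  (\<open>drop_row_of_largest_coefficient\<close>, \<open>square_mat_sim_exists\<close>). Hence the meet always exists.
  For distributivity suppose \<open>\<parallel>A\<parallel> \<le> \<parallel>B\<parallel>\<close>. Both matrices dominate the scalar matrix \<open>K\<close> with scalar
  \<open>\<parallel>B\<parallel>\<close>, so the stacked matrix \<open>E\<close> satisfies \<open>B \<succeq>\<^sub>n E \<succeq>\<^sub>n K\<close>. As \<open>B\<close> and \<open>K\<close> have equal norm,
  \<open>E \<box> C\<close> and \<open>B \<box> C\<close> are equivalent, and \<open>B \<box> C\<close> represents the meet on the other side because
  \<open>A \<box> C \<succeq>\<^sub>n B \<box> C\<close>.

  Joins fail because \<open>\<box>\<close> only sees norms: two distinct diagonal matrix units have norm \<open>1\<close>, but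
  a matrix dominating both vanishes on every unit vector, so their join is the class of \<open>0\<close>
  (\<open>join_diag_unit\<close>).
\<close>

section \<open>Domination as comparison of Gram forms\<close>

definition gram_form :: "'a::linordered_field mat \<Rightarrow> 'a vec \<Rightarrow> 'a" where
  "gram_form A v = (A *\<^sub>v v) \<bullet> (A *\<^sub>v v)"

lemma gram_form_eq_sum:
  assumes "A \<in> carrier_mat m n"
  shows "gram_form A v = (\<Sum>i<m. (row A i \<bullet> v)\<^sup>2)"
  using assms by (auto simp: gram_form_def scalar_prod_def[of "A *\<^sub>v v"] power2_eq_square
      lessThan_atLeast0 intro!: sum.cong)

lemma smult_mat_mult_vec:
  fixes A :: "'a::comm_semiring_0 mat"
  assumes "A \<in> carrier_mat m n" "v \<in> carrier_vec n"
  shows "(s \<cdot>\<^sub>m A) *\<^sub>v v = s \<cdot>\<^sub>v (A *\<^sub>v v)"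
  using assms by (intro eq_vecI) (auto simp: row_smult)

lemma gram_form_zero_mat:
  assumes "v \<in> carrier_vec n"
  shows "gram_form (0\<^sub>m m n) v = 0"
  using assms by (simp add: gram_form_eq_sum[of _ m n] row_def scalar_prod_def)

lemma gram_form_nonneg: "0 \<le> gram_form A v"
  by (auto simp: gram_form_def scalar_prod_def intro!: sum_nonneg)

lemma gram_form_unit_vec:
  assumes "A \<in> carrier_mat m n" "j < n"
  shows "gram_form A (unit_vec n j) = (\<Sum>i<m. (A $$ (i, j))\<^sup>2)"
  unfolding gram_form_eq_sum[OF assms(1)] using assms by (intro sum.cong) auto

lemma gram_form_append_rows:
  assumes "A \<in> carrier_mat m n" "B \<in> carrier_mat k n" "v \<in> carrier_vec n"
  shows "gram_form (A @\<^sub>r B) v = gram_form A v + gram_form B v"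
  unfolding gram_form_def mat_mult_append[OF assms]
  using assms by (intro scalar_prod_append[of _ m _ k]) auto

lemma gram_form_smult_one:
  assumes "v \<in> carrier_vec n"
  shows "gram_form (s \<cdot>\<^sub>m 1\<^sub>m n) v = s\<^sup>2 * (v \<bullet> v)"
  using assms by (simp add: gram_form_def smult_mat_mult_vec[where m = n and n = n] power2_eq_square mult.assoc)

lemma gram_form_mult:
  assumes "A \<in> carrier_mat m k" "B \<in> carrier_mat k n" "v \<in> carrier_vec n"
  shows "gram_form (A * B) v = gram_form A (B *\<^sub>v v)"
  using assms by (simp add: gram_form_def)

lemma quadratic_form_gram_mat:
  assumes "A \<in> carrier_mat m n" "v \<in> carrier_vec n"
  shows "v \<bullet> ((transpose_mat A * A) *\<^sub>v v) = gram_form A v"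
proof -
  have "v \<bullet> (transpose_mat A *\<^sub>v (A *\<^sub>v v)) = (transpose_mat (transpose_mat A) *\<^sub>v v) \<bullet> (A *\<^sub>v v)"
    using assms by (intro transpose_vec_mult_scalar[symmetric]) auto
  then show ?thesis
    using assms by (simp add: gram_form_def)
qed

text \<open>The quadratic form of \<open>r B\<^sup>T B - A\<^sup>T A\<close> at \<open>v\<close> is \<open>r q\<^sub>B(v) - q\<^sub>A(v)\<close>.\<close>

lemma dominates_iff:
  assumes A: "A \<in> carrier_mat m n" and B: "B \<in> carrier_mat k n"
  shows "A \<succeq>\<^bsub>n\<^esub> B \<longleftrightarrow> (\<exists>r::nat. \<forall>v\<in>carrier_vec n. gram_form A v \<le> of_nat r * gram_form B v)"
proof -
  have "v \<bullet> ((of_nat r \<cdot>\<^sub>m (transpose_mat B * B) - transpose_mat A * A) *\<^sub>v v)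
      = of_nat r * gram_form B v - gram_form A v" if v: "v \<in> carrier_vec n" for r :: nat and v
  proof -
    have TA: "transpose_mat A * A \<in> carrier_mat n n" and TB: "transpose_mat B * B \<in> carrier_mat n n"
      using A B by auto
    have "(of_nat r \<cdot>\<^sub>m (transpose_mat B * B) - transpose_mat A * A) *\<^sub>v v
       = of_nat r \<cdot>\<^sub>v ((transpose_mat B * B) *\<^sub>v v) - (transpose_mat A * A) *\<^sub>v v"
      using TA TB v by (subst minus_mult_distrib_mat_vec[where nr = n and nc = n])
        (auto simp: smult_mat_mult_vec[OF TB])
    also have "v \<bullet> \<dots> = of_nat r * (v \<bullet> ((transpose_mat B * B) *\<^sub>v v))
        - v \<bullet> ((transpose_mat A * A) *\<^sub>v v)"
      using TA TB v by (subst scalar_prod_minus_distrib[where n = n]) auto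
    finally show ?thesis
      using quadratic_form_gram_mat[OF A v] quadratic_form_gram_mat[OF B v] by simp
  qed
  then show ?thesis
    unfolding dominates_def loewner_le_def by auto
qed

lemma dominatesI:
  assumes "A \<in> carrier_mat m n" "B \<in> carrier_mat k n"
    and "\<And>v. v \<in> carrier_vec n \<Longrightarrow> gram_form A v \<le> of_nat r * gram_form B v"
  shows "A \<succeq>\<^bsub>n\<^esub> B"
  unfolding dominates_iff[OF assms(1,2)] using assms(3) by blast

lemma dominatesE:
  assumes "A \<succeq>\<^bsub>n\<^esub> B" "A \<in> carrier_mat m n" "B \<in> carrier_mat k n"
  obtains r :: nat where "\<And>v. v \<in> carrier_vec n \<Longrightarrow> gram_form A v \<le> of_nat r * gram_form B v"
  using assms(1) unfolding dominates_iff[OF assms(2,3)] by blast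

lemma dominates_refl: "A \<in> carrier_mat m n \<Longrightarrow> A \<succeq>\<^bsub>n\<^esub> A"
  by (rule dominatesI[where r = 1]) auto

lemma dominates_trans:
  assumes "A \<succeq>\<^bsub>n\<^esub> B" "B \<succeq>\<^bsub>n\<^esub> C"
    and A: "A \<in> carrier_mat m n" and B: "B \<in> carrier_mat k n" and C: "C \<in> carrier_mat l n"
  shows "A \<succeq>\<^bsub>n\<^esub> C"
proof -
  obtain r :: nat where r: "\<And>v. v \<in> carrier_vec n \<Longrightarrow> gram_form A v \<le> of_nat r * gram_form B v"
    using dominatesE[OF assms(1) A B] by blast
  obtain s :: nat where s: "\<And>v. v \<in> carrier_vec n \<Longrightarrow> gram_form B v \<le> of_nat s * gram_form C v"
    using dominatesE[OF assms(2) B C] by blast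
  show ?thesis
  proof (rule dominatesI[OF A C])
    fix v :: "'a vec" assume v: "v \<in> carrier_vec n"
    have "gram_form A v \<le> of_nat r * (of_nat s * gram_form C v)"
      by (rule order_trans[OF r[OF v] mult_left_mono[OF s[OF v]]]) simp
    then show "gram_form A v \<le> of_nat (r * s) * gram_form C v"
      by (simp add: mult.assoc)
  qed
qed

text \<open>The next two lemmas make the stacked matrix a greatest lower bound among matrices with \<open>n\<close>
  columns: its Gram form is the sum of the two given ones.\<close>

lemma dominates_append_rows:
  assumes A: "A \<in> carrier_mat m n" and B: "B \<in> carrier_mat k n"
  shows "A \<succeq>\<^bsub>n\<^esub> A @\<^sub>r B" and "B \<succeq>\<^bsub>n\<^esub> A @\<^sub>r B"
  by (rule dominatesI[where r = 1, OF _ carrier_append_rows[OF A B]];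
      use assms in \<open>simp add: gram_form_append_rows gram_form_nonneg\<close>)+

lemma append_rows_dominates:
  assumes "A \<succeq>\<^bsub>n\<^esub> D" "B \<succeq>\<^bsub>n\<^esub> D"
    and A: "A \<in> carrier_mat m n" and B: "B \<in> carrier_mat k n" and D: "D \<in> carrier_mat l n"
  shows "A @\<^sub>r B \<succeq>\<^bsub>n\<^esub> D"
proof -
  obtain r :: nat where r: "\<And>v. v \<in> carrier_vec n \<Longrightarrow> gram_form A v \<le> of_nat r * gram_form D v"
    using dominatesE[OF assms(1) A D] by blast
  obtain s :: nat where s: "\<And>v. v \<in> carrier_vec n \<Longrightarrow> gram_form B v \<le> of_nat s * gram_form D v"
    using dominatesE[OF assms(2) B D] by blast
  show ?thesis
  proof (rule dominatesI[OF carrier_append_rows[OF A B] D])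
    fix v :: "'a vec" assume v: "v \<in> carrier_vec n"
    show "gram_form (A @\<^sub>r B) v \<le> of_nat (r + s) * gram_form D v"
      using add_mono[OF r[OF v] s[OF v]]
      by (simp add: gram_form_append_rows[OF A B v] distrib_right)
  qed
qed

section \<open>The maximum norm\<close>

lemma max_norm_attained:
  assumes A: "A \<in> carrier_mat m n" and "0 < m" "0 < n"
  obtains i j where "i < m" "j < n" "max_norm A = \<bar>A $$ (i, j)\<bar>"
proof -
  have "finite (elements_mat A)" "elements_mat A \<noteq> {}"
    using elements_matI[OF A \<open>0 < m\<close> \<open>0 < n\<close> refl] by (auto simp: elements_mat_def)
  then have "max_norm A \<in> abs ` elements_mat A"
    unfolding max_norm_def by (intro Max_in) auto
  then show thesis
    using that A by auto
qed

lemma abs_entry_le_max_norm: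
  assumes "A \<in> carrier_mat m n" "i < m" "j < n"
  shows "\<bar>A $$ (i, j)\<bar> \<le> max_norm A"
  unfolding max_norm_def using elements_matI[OF assms refl]
  by (intro Max_ge) (auto simp: elements_mat_def)

lemma max_norm_nonneg:
  assumes "A \<in> carrier_mat m n" "0 < m" "0 < n"
  shows "0 \<le> max_norm A"
  using max_norm_attained[OF assms] by (metis abs_ge_zero)

lemma max_norm_eqI:
  assumes A: "A \<in> carrier_mat m n" and "i < m" "j < n" "\<bar>A $$ (i, j)\<bar> = c"
    and le: "\<And>i j. i < m \<Longrightarrow> j < n \<Longrightarrow> \<bar>A $$ (i, j)\<bar> \<le> c"
  shows "max_norm A = c"
proof (rule antisym)
  show "max_norm A \<le> c"
    using max_norm_attained[OF A] le assms(2,3) by (metis gr_zeroI not_less_zero)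
  show "c \<le> max_norm A"
    using abs_entry_le_max_norm[OF A assms(2,3)] assms(4) by simp
qed

lemma max_norm_smult_one: "0 < n \<Longrightarrow> max_norm (s \<cdot>\<^sub>m 1\<^sub>m n) = \<bar>s\<bar>"
  by (rule max_norm_eqI[where m = n and n = n and i = 0 and j = 0]) auto

text \<open>The case of the Cauchy--Schwarz inequality with a constant factor; it holds in every ordered
  field, since the difference of the two sides is half of \<open>\<Sum>i. \<Sum>j. (x\<^sub>i - x\<^sub>j)\<^sup>2\<close>.\<close>

lemma sum_power2_le:
  fixes x :: "'i \<Rightarrow> 'a::linordered_field"
  shows "(\<Sum>i\<in>I. x i)\<^sup>2 \<le> of_nat (card I) * (\<Sum>i\<in>I. (x i)\<^sup>2)"
proof -
  have "0 \<le> (\<Sum>i\<in>I. \<Sum>j\<in>I. (x i - x j)\<^sup>2)"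
    by (intro sum_nonneg) auto
  also have "\<dots> = (\<Sum>i\<in>I. \<Sum>j\<in>I. (x i)\<^sup>2 + (x j)\<^sup>2 - 2 * (x i * x j))"
    by (simp add: power2_diff mult.assoc)
  also have "\<dots> = 2 * (of_nat (card I) * (\<Sum>i\<in>I. (x i)\<^sup>2)) - 2 * (\<Sum>i\<in>I. x i)\<^sup>2"
    by (simp add: sum.distrib sum_subtractf power2_eq_square sum_product flip: sum_distrib_left)
  finally show ?thesis by simp
qed

lemma gram_form_le_max_norm:
  assumes A: "A \<in> carrier_mat m n" and v: "v \<in> carrier_vec n"
  shows "gram_form A v \<le> of_nat (m * n) * ((max_norm A)\<^sup>2 * (v \<bullet> v))"
proof -
  have row: "(row A i \<bullet> v)\<^sup>2 \<le> of_nat n * ((max_norm A)\<^sup>2 * (v \<bullet> v))" if "i < m" for i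
  proof -
    have "(row A i \<bullet> v)\<^sup>2 = (\<Sum>j<n. A $$ (i, j) * v $ j)\<^sup>2"
      using A v that by (simp add: scalar_prod_def lessThan_atLeast0)
    also have "\<dots> \<le> of_nat n * (\<Sum>j<n. (A $$ (i, j) * v $ j)\<^sup>2)"
      using sum_power2_le[of "\<lambda>j. A $$ (i, j) * v $ j" "{..<n}"] by simp
    also have "\<dots> \<le> of_nat n * (\<Sum>j<n. (max_norm A)\<^sup>2 * (v $ j)\<^sup>2)"
      using abs_entry_le_max_norm[OF A \<open>i < m\<close>]
      by (auto simp: power_mult_distrib abs_le_square_iff intro!: mult_left_mono sum_mono
          mult_right_mono intro: order_trans[OF _ abs_ge_self])
        (metis abs_ge_zero abs_le_square_iff abs_of_nonneg order_trans)
    also have "\<dots> = of_nat n * ((max_norm A)\<^sup>2 * (v \<bullet> v))"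
      using v by (simp add: scalar_prod_def lessThan_atLeast0 sum_distrib_left power2_eq_square)
    finally show ?thesis .
  qed
  have "gram_form A v \<le> (\<Sum>i<m. of_nat n * ((max_norm A)\<^sup>2 * (v \<bullet> v)))"
    unfolding gram_form_eq_sum[OF A] by (intro sum_mono row) simp
  then show ?thesis by (simp add: mult.assoc)
qed

lemma dominates_smult_one:
  assumes A: "A \<in> carrier_mat m n" "0 < m" "0 < n" and le: "max_norm A \<le> s"
  shows "A \<succeq>\<^bsub>n\<^esub> s \<cdot>\<^sub>m 1\<^sub>m n"
proof (rule dominatesI[where k = n, OF A(1)])
  fix v :: "'a vec" assume v: "v \<in> carrier_vec n"
  have "(max_norm A)\<^sup>2 \<le> s\<^sup>2"
    using le max_norm_nonneg[OF A] by (rule power_mono)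
  moreover have "0 \<le> v \<bullet> v"
    by (auto simp: scalar_prod_def intro!: sum_nonneg)
  ultimately have "(max_norm A)\<^sup>2 * (v \<bullet> v) \<le> gram_form (s \<cdot>\<^sub>m 1\<^sub>m n) v"
    unfolding gram_form_smult_one[OF v] by (rule mult_right_mono)
  then show "gram_form A v \<le> of_nat (m * n) * gram_form (s \<cdot>\<^sub>m 1\<^sub>m n) v"
    by (intro order_trans[OF gram_form_le_max_norm[OF A(1) v]] mult_left_mono) auto
qed simp

text \<open>The squared entries of column \<open>j\<close> sum to the Gram form at the \<open>j\<close>-th unit vector, so comparing
  Gram forms there compares the largest entry of \<open>A\<close> with those of \<open>B\<close>.\<close>

lemma dominates_imp_max_norm_le:
  assumes "A \<succeq>\<^bsub>n\<^esub> B" and A: "A \<in> carrier_mat m n" "0 < m" and B: "B \<in> carrier_mat k n" "0 < k"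
    and n: "0 < n"
  obtains r :: nat where "max_norm A \<le> of_nat r * max_norm B"
proof -
  obtain r :: nat where r: "\<And>v. v \<in> carrier_vec n \<Longrightarrow> gram_form A v \<le> of_nat r * gram_form B v"
    using dominatesE[OF assms(1) A(1) B(1)] by blast
  obtain i j where ij: "i < m" "j < n" and max: "max_norm A = \<bar>A $$ (i, j)\<bar>"
    using max_norm_attained[OF A n] .
  let ?b = "max_norm B"
  have "(max_norm A)\<^sup>2 = (A $$ (i, j))\<^sup>2"
    by (simp add: max)
  also have "\<dots> \<le> gram_form A (unit_vec n j)"
    unfolding gram_form_unit_vec[OF A(1) ij(2)] using ij by (intro member_le_sum) auto
  also have "\<dots> \<le> of_nat r * gram_form B (unit_vec n j)"
    by (rule r) simp
  also have "gram_form B (unit_vec n j) \<le> (\<Sum>i<k. ?b\<^sup>2)"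
    unfolding gram_form_unit_vec[OF B(1) ij(2)]
    using abs_entry_le_max_norm[OF B(1) _ ij(2)] max_norm_nonneg[OF B n]
    by (intro sum_mono) (auto simp flip: abs_le_square_iff)
  finally have "(max_norm A)\<^sup>2 \<le> of_nat (r * k) * ?b\<^sup>2"
    by (simp add: mult_left_mono mult.assoc)
  \<comment> \<open>Square roots need not exist in the field, so the factor is enlarged to a perfect square.\<close>
  also have "\<dots> \<le> of_nat ((r * k + 1)\<^sup>2) * ?b\<^sup>2"
    by (intro mult_right_mono of_nat_mono) (auto simp: power2_eq_square)
  also have "\<dots> = (of_nat (r * k + 1) * ?b)\<^sup>2"
    by (simp only: power_mult_distrib of_nat_power)
  finally show thesis
    using that power2_le_imp_le max_norm_nonneg[OF B n] by (metis of_nat_0_le_iff mult_nonneg_nonneg)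
qed

section \<open>Reduction to square matrices\<close>

text \<open>Solving the dependence for the term with the largest coefficient leaves quotients of absolute
  value at most \<open>1\<close>. This is what makes the constant a natural number instead of an arbitrary, possibly
  infinitely large, field element.\<close>

lemma drop_row_of_largest_coefficient:
  fixes y c :: "'i \<Rightarrow> 'a::linordered_field"
  assumes fin: "finite I" and k: "k \<in> I" "c k \<noteq> 0" and max: "\<And>i. i \<in> I \<Longrightarrow> \<bar>c i\<bar> \<le> \<bar>c k\<bar>"
    and dep: "(\<Sum>i\<in>I. c i * y i) = 0"
  shows "(\<Sum>i\<in>I. (y i)\<^sup>2) \<le> of_nat (card I) * (\<Sum>i\<in>I - {k}. (y i)\<^sup>2)"
proof -
  let ?J = "I - {k}"
  have "c k * y k = - (\<Sum>i\<in>?J. c i * y i)"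
    using dep by (simp add: sum.remove[OF fin k(1)] eq_neg_iff_add_eq_0)
  then have "y k = - (\<Sum>i\<in>?J. c i * y i) / c k"
    using k(2) by (simp add: field_simps)
  then have "y k = - (\<Sum>i\<in>?J. (c i / c k) * y i)"
    by (simp add: sum_divide_distrib)
  then have "(y k)\<^sup>2 = (\<Sum>i\<in>?J. (c i / c k) * y i)\<^sup>2"
    by simp
  also have "\<dots> \<le> of_nat (card ?J) * (\<Sum>i\<in>?J. ((c i / c k) * y i)\<^sup>2)"
    by (rule sum_power2_le)
  also have "\<dots> \<le> of_nat (card ?J) * (\<Sum>i\<in>?J. (y i)\<^sup>2)"
  proof (intro mult_left_mono sum_mono)
    fix i assume "i \<in> ?J"
    then have "\<bar>c i / c k\<bar> \<le> 1"
      using max[of i] k(2) by (simp add: abs_divide divide_le_eq)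
    then have "(c i / c k)\<^sup>2 \<le> 1"
      by (simp add: abs_square_le_1)
    then show "((c i / c k) * y i)\<^sup>2 \<le> (y i)\<^sup>2"
      unfolding power_mult_distrib by (rule mult_left_le_one_le[rotated -1]) auto
  qed simp
  finally have "(\<Sum>i\<in>I. (y i)\<^sup>2) \<le> (1 + of_nat (card ?J)) * (\<Sum>i\<in>?J. (y i)\<^sup>2)"
    by (simp add: sum.remove[OF fin k(1)] distrib_right)
  also have "1 + of_nat (card ?J) = (of_nat (card I) :: 'a)"
    using card.remove[OF fin k(1)] by simp
  finally show ?thesis .
qed

lemma rows_dependent:
  fixes e :: "nat \<Rightarrow> 'a::field vec"
  assumes e: "\<And>i. i \<le> n \<Longrightarrow> e i \<in> carrier_vec n"
  obtains c i where "i \<le> n" "c i \<noteq> 0"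
    "\<And>v. v \<in> carrier_vec n \<Longrightarrow> (\<Sum>i\<le>n. c i * (e i \<bullet> v)) = 0"
proof -
  \<comment> \<open>A zero column makes the rows into a singular square matrix; a kernel vector of the transpose
    is the dependence.\<close>
  define M where "M = mat (Suc n) (Suc n) (\<lambda>(i, j). if j < n then e i $ j else 0)"
  have M: "M \<in> carrier_mat (Suc n) (Suc n)"
    by (simp add: M_def)
  have "row M i \<bullet> unit_vec (Suc n) n = 0" if "i < Suc n" for i
    using that M by (simp add: M_def)
  then have "M *\<^sub>v unit_vec (Suc n) n = 0\<^sub>v (Suc n)"
    using M by (intro eq_vecI) auto
  moreover have "unit_vec (Suc n) n \<noteq> (0\<^sub>v (Suc n) :: 'a vec)"
    by (metis index_unit_vec(2) index_zero_vec(1) lessI zero_neq_one)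
  ultimately have "det M = 0"
    using det_0_iff_vec_prod_zero_field[OF M] by (metis unit_vec_carrier)
  then have "det (transpose_mat M) = 0"
    by (simp add: det_transpose[OF M])
  then obtain u where u: "u \<in> carrier_vec (Suc n)" "u \<noteq> 0\<^sub>v (Suc n)"
    and Mu: "transpose_mat M *\<^sub>v u = 0\<^sub>v (Suc n)"
    using det_0_iff_vec_prod_zero_field[of "transpose_mat M" "Suc n"] M by auto
  obtain i where i: "i < Suc n" "u $ i \<noteq> 0"
    using u by (metis carrier_vecD eq_vecI index_zero_vec)
  have col: "(\<Sum>i\<le>n. u $ i * e i $ j) = 0" if "j < n" for j
  proof -
    have "0 = (transpose_mat M *\<^sub>v u) $ j"
      using Mu that by simp
    also have "\<dots> = col M j \<bullet> u"
      using M that by simp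
    also have "\<dots> = (\<Sum>i\<in>{0..<Suc n}. M $$ (i, j) * u $ i)"
      using M u that unfolding scalar_prod_def by (intro sum.cong) auto
    also have "\<dots> = (\<Sum>i\<le>n. u $ i * e i $ j)"
      using that by (intro sum.cong) (auto simp: M_def)
    finally show ?thesis by simp
  qed
  have "(\<Sum>i\<le>n. u $ i * (e i \<bullet> v)) = 0" if "v \<in> carrier_vec n" for v
  proof -
    have "(\<Sum>i\<le>n. u $ i * (e i \<bullet> v)) = (\<Sum>i\<le>n. \<Sum>j<n. u $ i * e i $ j * v $ j)"
      using that by (simp add: scalar_prod_def sum_distrib_left mult.assoc lessThan_atLeast0)
    also have "\<dots> = (\<Sum>j<n. (\<Sum>i\<le>n. u $ i * e i $ j) * v $ j)"
      by (subst sum.swap) (simp add: sum_distrib_right)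
    also have "\<dots> = 0"
      by (simp add: col)
    finally show ?thesis .
  qed
  with i show thesis
    by (intro that[of i "\<lambda>i. u $ i"]) auto
qed

text \<open>Appending a row to a square matrix and discarding the redundant one of the \<open>n + 1\<close> rows keeps
  the shape and changes the Gram form only up to the factor \<open>n + 1\<close>.\<close>

lemma absorb_row:
  fixes E :: "'a::linordered_field mat"
  assumes E: "E \<in> carrier_mat n n" and x: "x \<in> carrier_vec n"
  obtains E' where "E' \<in> carrier_mat n n"
    "\<And>v. v \<in> carrier_vec n \<Longrightarrow> gram_form E' v \<le> gram_form E v + (x \<bullet> v)\<^sup>2"
    "\<And>v. v \<in> carrier_vec n \<Longrightarrow> gram_form E v + (x \<bullet> v)\<^sup>2 \<le> of_nat (Suc n) * gram_form E' v"
proof -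
  define e where "e i = (if i < n then row E i else x)" for i
  have e: "e i \<in> carrier_vec n" for i
    using E x by (auto simp: e_def)
  obtain c i0 where i0: "i0 \<le> n" "c i0 \<noteq> 0"
    and dep: "\<And>v. v \<in> carrier_vec n \<Longrightarrow> (\<Sum>i\<le>n. c i * (e i \<bullet> v)) = 0"
    by (rule rows_dependent[of n e, OF e]) (rule that)
  let ?cs = "(\<lambda>i. \<bar>c i\<bar>) ` {..n}"
  have "Max ?cs \<in> ?cs"
    by (rule Max_in) auto
  then obtain k where k: "k \<le> n" and "\<bar>c k\<bar> = Max ?cs"
    by (rule imageE) (metis atMost_iff that)
  then have maxk: "\<bar>c i\<bar> \<le> \<bar>c k\<bar>" if "i \<le> n" for i
    using that by simp
  have ck: "c k \<noteq> 0"
    using maxk[OF i0(1)] i0(2) by auto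
  \<comment> \<open>The new row, of index \<open>n\<close>, takes the place of the discarded row \<open>k\<close>; for \<open>k = n\<close> it is itself
    discarded.\<close>
  define E' where "E' = mat n n (\<lambda>(i, j). e (if i = k then n else i) $ j)"
  have E': "E' \<in> carrier_mat n n"
    by (simp add: E'_def)
  have row: "row E' i = e (if i = k then n else i)" if "i < n" for i
    using that e by (intro eq_vecI) (auto simp: E'_def carrier_vecD[OF e])
  have all: "gram_form E v + (x \<bullet> v)\<^sup>2 = (\<Sum>i\<le>n. (e i \<bullet> v)\<^sup>2)" for v
    unfolding gram_form_eq_sum[OF E] by (simp add: e_def lessThan_Suc_atMost[symmetric])
  have dropped: "gram_form E' v = (\<Sum>i\<in>{..n} - {k}. (e i \<bullet> v)\<^sup>2)" for v
    unfolding gram_form_eq_sum[OF E'] using k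
    by (intro sum.reindex_bij_witness[where j = "\<lambda>i. if i = k then n else i"
          and i = "\<lambda>i. if i = n then k else i"]) (auto simp: row)
  show thesis
  proof (rule that[OF E'])
    fix v :: "'a vec" assume v: "v \<in> carrier_vec n"
    show "gram_form E' v \<le> gram_form E v + (x \<bullet> v)\<^sup>2"
      unfolding all dropped by (intro sum_mono2) auto
    show "gram_form E v + (x \<bullet> v)\<^sup>2 \<le> of_nat (Suc n) * gram_form E' v"
      unfolding all dropped
      using drop_row_of_largest_coefficient[of "{..n}" k c "\<lambda>i. e i \<bullet> v"] k ck maxk dep[OF v]
      by simp
  qed
qed

text \<open>Every class of matrices with \<open>n\<close> columns thus contains a square matrix. The rows of \<open>D\<close> are absorbed one after the other, starting from the zero
  matrix.\<close>

lemma square_mat_sim_exists: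
  fixes D :: "'a::linordered_field mat"
  assumes "D \<in> carrier_mat m n"
  obtains E where "E \<in> carrier_mat n n" "E \<sim>\<^bsub>n\<^esub> D"
proof -
  have "\<exists>E\<in>carrier_mat n n. E \<succeq>\<^bsub>n\<^esub> D \<and> D \<succeq>\<^bsub>n\<^esub> E"
    using assms
  proof (induction m arbitrary: D)
    case 0
    have "gram_form D v = 0" "gram_form (0\<^sub>m n n :: 'a mat) v = 0" if "v \<in> carrier_vec n" for v
      using that by (auto simp: gram_form_eq_sum[OF 0] gram_form_zero_mat)
    then show ?case
      using 0 by (intro bexI[of _ "0\<^sub>m n n"] conjI dominatesI[where r = 0]) auto
  next
    case (Suc m)
    define D' where "D' = mat m n (\<lambda>(i, j). D $$ (i, j))"
    have D': "D' \<in> carrier_mat m n"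
      by (simp add: D'_def)
    have "row D' i = row D i" if "i < m" for i
      using that Suc.prems by (intro eq_vecI) (auto simp: D'_def)
    then have split: "gram_form D v = gram_form D' v + (row D m \<bullet> v)\<^sup>2" for v
      by (simp add: gram_form_eq_sum[OF D'] gram_form_eq_sum[OF Suc.prems])
    obtain E where E: "E \<in> carrier_mat n n" "E \<succeq>\<^bsub>n\<^esub> D'" "D' \<succeq>\<^bsub>n\<^esub> E"
      using Suc.IH[OF D'] by blast
    obtain r :: nat where r: "\<And>v. v \<in> carrier_vec n \<Longrightarrow> gram_form E v \<le> of_nat r * gram_form D' v"
      using dominatesE[OF E(2,1) D'] by blast
    obtain s :: nat where s: "\<And>v. v \<in> carrier_vec n \<Longrightarrow> gram_form D' v \<le> of_nat s * gram_form E v"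
      using dominatesE[OF E(3) D' E(1)] by blast
    have x: "row D m \<in> carrier_vec n"
      using Suc.prems by auto
    obtain E' where E': "E' \<in> carrier_mat n n"
      and le: "\<And>v. v \<in> carrier_vec n \<Longrightarrow> gram_form E' v \<le> gram_form E v + (row D m \<bullet> v)\<^sup>2"
      and ge: "\<And>v. v \<in> carrier_vec n \<Longrightarrow>
        gram_form E v + (row D m \<bullet> v)\<^sup>2 \<le> of_nat (Suc n) * gram_form E' v"
      using absorb_row[OF E(1) x] by blast
    have weaken: "p + q \<le> of_nat (Suc t) * (p' + q)" 
      if "p \<le> of_nat t * p'" "0 \<le> p'" "0 \<le> q" for p q p' :: 'a and t :: nat
    proof -
      have "0 \<le> of_nat t * q"
        using \<open>0 \<le> q\<close> by simp
      with that(1,2) have "p + q \<le> (of_nat t * p' + p') + (of_nat t * q + q)"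
        by linarith
      then show ?thesis
        by (simp add: algebra_simps)
    qed
    have "E' \<succeq>\<^bsub>n\<^esub> D"
    proof (rule dominatesI[OF E' Suc.prems])
      fix v :: "'a vec" assume v: "v \<in> carrier_vec n"
      show "gram_form E' v \<le> of_nat (Suc r) * gram_form D v"
        unfolding split
        by (rule order_trans[OF le[OF v] weaken[OF r[OF v]]]) (simp_all add: gram_form_nonneg)
    qed
    moreover have "D \<succeq>\<^bsub>n\<^esub> E'"
    proof (rule dominatesI[OF Suc.prems E'])
      fix v :: "'a vec" assume v: "v \<in> carrier_vec n"
      have "gram_form D v \<le> of_nat (Suc s) * (gram_form E v + (row D m \<bullet> v)\<^sup>2)"
        unfolding split by (rule weaken[OF s[OF v]]) (simp_all add: gram_form_nonneg)
      also have "\<dots> \<le> of_nat (Suc s) * (of_nat (Suc n) * gram_form E' v)"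
        by (intro mult_left_mono ge[OF v] of_nat_0_le_iff)
      finally show "gram_form D v \<le> of_nat (Suc s * Suc n) * gram_form E' v"
        by (simp only: of_nat_mult mult.assoc)
    qed
    ultimately show ?case
      using E' by blast
  qed
  then show thesis
    using that by (auto simp: mat_sim_def)
qed

section \<open>The poset of classes\<close>

lemma equiv_sim_rel: "equiv (carrier_mat n n) (sim_rel n :: 'a::linordered_field mat rel)"
proof (rule equivI)
  show "trans (sim_rel n :: 'a mat rel)"
    by (rule transI) (auto simp: sim_rel_def mat_sim_def intro: dominates_trans)
qed (auto simp: sim_rel_def mat_sim_def refl_on_def sym_def intro: dominates_refl)

lemma mem_v_class:
  "A \<in> carrier_mat n n \<Longrightarrow> X \<in> v_class n A \<longleftrightarrow> X \<in> carrier_mat n n \<and> A \<sim>\<^bsub>n\<^esub> X"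
  by (auto simp: v_class_def sim_rel_def)

lemma v_class_eq_iff:
  "A \<in> carrier_mat n n \<Longrightarrow> B \<in> carrier_mat n n \<Longrightarrow> v_class n A = v_class n B \<longleftrightarrow> A \<sim>\<^bsub>n\<^esub> B"
  unfolding v_class_def eq_equiv_class_iff[OF equiv_sim_rel] by (simp add: sim_rel_def)

lemma self_mem_v_class: "A \<in> carrier_mat n n \<Longrightarrow> A \<in> v_class n A"
  by (simp add: mem_v_class mat_sim_def dominates_refl)

lemma carrier_v_poset: "carrier (v_poset n) = v_class n ` carrier_mat n n"
  by (auto simp: v_poset_def quotient_def v_class_def)

lemma v_class_le_iff:
  assumes A: "A \<in> carrier_mat n n" and B: "B \<in> carrier_mat n n"
  shows "v_class n B \<sqsubseteq>\<^bsub>v_poset n\<^esub> v_class n A \<longleftrightarrow> A \<succeq>\<^bsub>n\<^esub> B"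
proof
  assume "v_class n B \<sqsubseteq>\<^bsub>v_poset n\<^esub> v_class n A"
  then obtain A' B' where "A' \<in> v_class n A" "B' \<in> v_class n B" "A' \<succeq>\<^bsub>n\<^esub> B'"
    by (auto simp: v_poset_def)
  then show "A \<succeq>\<^bsub>n\<^esub> B"
    using A B by (auto simp: mem_v_class mat_sim_def intro: dominates_trans)
next
  assume "A \<succeq>\<^bsub>n\<^esub> B"
  then show "v_class n B \<sqsubseteq>\<^bsub>v_poset n\<^esub> v_class n A"
    using self_mem_v_class[OF A] self_mem_v_class[OF B] by (auto simp: v_poset_def)
qed

lemma partial_order_v_poset: "partial_order (v_poset n :: 'a::linordered_field mat set gorder)"
proof
  show eq: "(.=\<^bsub>v_poset n\<^esub>) = ((=) :: 'a mat set \<Rightarrow> _)"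
    by (simp add: v_poset_def)
next
  fix x y z w :: "'a mat set"
  assume "x .=\<^bsub>v_poset n\<^esub> y" "z .=\<^bsub>v_poset n\<^esub> w"
  then show "(x \<sqsubseteq>\<^bsub>v_poset n\<^esub> z) = (y \<sqsubseteq>\<^bsub>v_poset n\<^esub> w)"
    by (simp add: v_poset_def)
next
  fix x y :: "'a mat set"
  assume "x \<sqsubseteq>\<^bsub>v_poset n\<^esub> y" "y \<sqsubseteq>\<^bsub>v_poset n\<^esub> x" "x \<in> carrier (v_poset n)" "y \<in> carrier (v_poset n)"
  then have "x = y"
    unfolding carrier_v_poset by (metis imageE mat_sim_def v_class_eq_iff v_class_le_iff)
  then show "x .=\<^bsub>v_poset n\<^esub> y"
    by (simp add: v_poset_def)
next
  fix x y z :: "'a mat set"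
  assume "x \<sqsubseteq>\<^bsub>v_poset n\<^esub> y" "y \<sqsubseteq>\<^bsub>v_poset n\<^esub> z" "x \<in> carrier (v_poset n)"
    "y \<in> carrier (v_poset n)" "z \<in> carrier (v_poset n)"
  then show "x \<sqsubseteq>\<^bsub>v_poset n\<^esub> z"
    by (auto simp: carrier_v_poset v_class_le_iff intro: dominates_trans)
qed (auto simp: carrier_v_poset v_class_le_iff intro: dominates_refl, auto simp: v_poset_def)

text \<open>The operators \<open>\<sqinter>\<close> and \<open>\<squnion>\<close> choose some extremal bound. Antisymmetry makes greatest and least
  elements unique, which identifies the chosen element in the next two lemmas.\<close>

lemma meet_v_class_eqI:
  assumes M: "A \<in> carrier_mat n n" "B \<in> carrier_mat n n" "E \<in> carrier_mat n n"
    and "A \<succeq>\<^bsub>n\<^esub> E" "B \<succeq>\<^bsub>n\<^esub> E"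
    and "\<And>D. D \<in> carrier_mat n n \<Longrightarrow> A \<succeq>\<^bsub>n\<^esub> D \<Longrightarrow> B \<succeq>\<^bsub>n\<^esub> D \<Longrightarrow> E \<succeq>\<^bsub>n\<^esub> D"
  shows "v_class n A \<sqinter>\<^bsub>v_poset n\<^esub> v_class n B = v_class n E"
proof -
  have "greatest (v_poset n) (v_class n E) (Lower (v_poset n) {v_class n A, v_class n B})"
    using assms by (auto simp: greatest_def Lower_def carrier_v_poset v_class_le_iff)
  then show ?thesis
    unfolding meet_def inf_def
    by (metis (no_types, lifting) partial_order.greatest_unique[OF partial_order_v_poset] someI)
qed

lemma join_v_class_eqI:
  assumes M: "A \<in> carrier_mat n n" "B \<in> carrier_mat n n" "E \<in> carrier_mat n n"
    and "E \<succeq>\<^bsub>n\<^esub> A" "E \<succeq>\<^bsub>n\<^esub> B"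
    and "\<And>D. D \<in> carrier_mat n n \<Longrightarrow> D \<succeq>\<^bsub>n\<^esub> A \<Longrightarrow> D \<succeq>\<^bsub>n\<^esub> B \<Longrightarrow> D \<succeq>\<^bsub>n\<^esub> E"
  shows "v_class n A \<squnion>\<^bsub>v_poset n\<^esub> v_class n B = v_class n E"
proof -
  have "least (v_poset n) (v_class n E) (Upper (v_poset n) {v_class n A, v_class n B})"
    using assms by (auto simp: least_def Upper_def carrier_v_poset v_class_le_iff)
  then show ?thesis
    unfolding join_def sup_def
    by (metis (no_types, lifting) partial_order.least_unique[OF partial_order_v_poset] someI)
qed

lemma meet_v_class_of_dominates:
  assumes "A \<in> carrier_mat n n" "B \<in> carrier_mat n n" "A \<succeq>\<^bsub>n\<^esub> B"
  shows "v_class n A \<sqinter>\<^bsub>v_poset n\<^esub> v_class n B = v_class n B"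
  using assms by (intro meet_v_class_eqI) (auto intro: dominates_refl)

lemma meet_v_class_append_rows:
  fixes A B :: "'a::linordered_field mat"
  assumes A: "A \<in> carrier_mat n n" and B: "B \<in> carrier_mat n n"
  obtains E where "E \<in> carrier_mat n n" "E \<sim>\<^bsub>n\<^esub> A @\<^sub>r B"
    "v_class n A \<sqinter>\<^bsub>v_poset n\<^esub> v_class n B = v_class n E"
proof -
  have AB: "A @\<^sub>r B \<in> carrier_mat (n + n) n"
    using A B by simp
  obtain E where E: "E \<in> carrier_mat n n" and sim: "E \<sim>\<^bsub>n\<^esub> A @\<^sub>r B"
    using square_mat_sim_exists[OF AB] .
  have "v_class n A \<sqinter>\<^bsub>v_poset n\<^esub> v_class n B = v_class n E"
  proof (rule meet_v_class_eqI[OF A B E])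
    show "A \<succeq>\<^bsub>n\<^esub> E" "B \<succeq>\<^bsub>n\<^esub> E"
      using sim dominates_append_rows[OF A B] dominates_trans[OF _ _ _ AB E] A B
      by (auto simp: mat_sim_def)
  next
    fix D assume "D \<in> carrier_mat n n" "A \<succeq>\<^bsub>n\<^esub> D" "B \<succeq>\<^bsub>n\<^esub> D"
    then show "E \<succeq>\<^bsub>n\<^esub> D"
      using sim append_rows_dominates[OF _ _ A B] dominates_trans[OF _ _ E AB]
      by (auto simp: mat_sim_def)
  qed
  then show thesis
    using that E sim by blast
qed

section \<open>The square operation\<close>

lemma square_op_carrier [simp]: "A \<box>\<^bsub>n\<^esub> B \<in> carrier_mat n n"
  by (simp add: square_op_def)

lemma square_op_commute: "A \<box>\<^bsub>n\<^esub> B = B \<box>\<^bsub>n\<^esub> A"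
  by (simp add: square_op_def mult.commute)

lemma max_norm_square_op:
  assumes "A \<in> carrier_mat m n" "B \<in> carrier_mat k n" "0 < m" "0 < k" "0 < n"
  shows "max_norm (A \<box>\<^bsub>n\<^esub> B) = max_norm A * max_norm B"
  using assms max_norm_nonneg[of A m n] max_norm_nonneg[of B k n]
  by (simp add: square_op_def max_norm_smult_one)

lemma square_op_assoc:
  assumes "A \<in> carrier_mat n n" "B \<in> carrier_mat n n" "C \<in> carrier_mat n n" "0 < n"
  shows "(A \<box>\<^bsub>n\<^esub> B) \<box>\<^bsub>n\<^esub> C = A \<box>\<^bsub>n\<^esub> (B \<box>\<^bsub>n\<^esub> C)"
  using assms
  by (simp add: square_op_def[of "A \<box>\<^bsub>n\<^esub> B"] square_op_def[of A _ "B \<box>\<^bsub>n\<^esub> C"]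
      max_norm_square_op[where m = n and k = n] mult.assoc)

lemma smult_one_dominates:
  fixes s t :: "'a::linordered_field"
  assumes "\<bar>s\<bar> \<le> of_nat r * \<bar>t\<bar>"
  shows "s \<cdot>\<^sub>m 1\<^sub>m n \<succeq>\<^bsub>n\<^esub> t \<cdot>\<^sub>m 1\<^sub>m n"
proof (rule dominatesI[where m = n and k = n])
  fix v :: "'a vec" assume v: "v \<in> carrier_vec n"
  have "s\<^sup>2 \<le> of_nat (r\<^sup>2) * t\<^sup>2"
    using power_mono[OF assms, of 2] by (simp add: power_mult_distrib)
  moreover have "0 \<le> v \<bullet> v"
    by (auto simp: scalar_prod_def intro!: sum_nonneg)
  ultimately have "s\<^sup>2 * (v \<bullet> v) \<le> of_nat (r\<^sup>2) * t\<^sup>2 * (v \<bullet> v)"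
    by (rule mult_right_mono)
  then show "gram_form (s \<cdot>\<^sub>m 1\<^sub>m n) v \<le> of_nat (r\<^sup>2) * gram_form (t \<cdot>\<^sub>m 1\<^sub>m n) v"
    unfolding gram_form_smult_one[OF v] by (simp only: mult.assoc)
qed simp_all

text \<open>Domination passes to the norms up to a natural factor, and scalar matrices are compared by their
  scalars.\<close>

lemma square_op_mono_left:
  assumes "A \<succeq>\<^bsub>n\<^esub> B" and A: "A \<in> carrier_mat m n" "0 < m" and B: "B \<in> carrier_mat k n" "0 < k"
    and C: "C \<in> mats_cols n" and n: "0 < n"
  shows "A \<box>\<^bsub>n\<^esub> C \<succeq>\<^bsub>n\<^esub> B \<box>\<^bsub>n\<^esub> C"
proof -
  obtain l where C': "C \<in> carrier_mat l n" "0 < l"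
    using C by (force simp: mats_cols_def)
  obtain r :: nat where r: "max_norm A \<le> of_nat r * max_norm B"
    using dominates_imp_max_norm_le[OF assms(1) A B n] .
  have "max_norm A * max_norm C \<le> of_nat r * (max_norm B * max_norm C)"
    using mult_right_mono[OF r max_norm_nonneg[OF C' n]] by (simp add: mult.assoc)
  then show ?thesis
    unfolding square_op_def
    using max_norm_nonneg[OF A n] max_norm_nonneg[OF B n] max_norm_nonneg[OF C' n]
    by (intro smult_one_dominates[of _ r]) simp
qed

lemma carrier_mat_mem_mats_cols: "A \<in> carrier_mat n n \<Longrightarrow> 0 < n \<Longrightarrow> A \<in> mats_cols n"
  by (force simp: mats_cols_def)

lemma square_op_cong:
  assumes sim: "A \<sim>\<^bsub>n\<^esub> A'" "B \<sim>\<^bsub>n\<^esub> B'"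
    and M: "A \<in> carrier_mat n n" "A' \<in> carrier_mat n n" "B \<in> carrier_mat n n" "B' \<in> carrier_mat n n"
    and n: "0 < n"
  shows "A \<box>\<^bsub>n\<^esub> B \<sim>\<^bsub>n\<^esub> A' \<box>\<^bsub>n\<^esub> B'"
proof -
  have mono: "A \<box>\<^bsub>n\<^esub> B \<succeq>\<^bsub>n\<^esub> A' \<box>\<^bsub>n\<^esub> B'"
    if "A \<succeq>\<^bsub>n\<^esub> A'" "B \<succeq>\<^bsub>n\<^esub> B'" and M: "A \<in> carrier_mat n n" "A' \<in> carrier_mat n n"
      "B \<in> carrier_mat n n" "B' \<in> carrier_mat n n" for A A' B B' :: "'a mat"
  proof (rule dominates_trans)
    show "A \<box>\<^bsub>n\<^esub> B \<succeq>\<^bsub>n\<^esub> A' \<box>\<^bsub>n\<^esub> B"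
      using square_op_mono_left[OF that(1) M(1) n M(2) n] carrier_mat_mem_mats_cols M n by blast
    show "A' \<box>\<^bsub>n\<^esub> B \<succeq>\<^bsub>n\<^esub> A' \<box>\<^bsub>n\<^esub> B'"
      unfolding square_op_commute[of A']
      using square_op_mono_left[OF that(2) M(3) n M(4) n] carrier_mat_mem_mats_cols M n by blast
  qed (rule square_op_carrier)+
  show ?thesis
    using sim M by (auto simp: mat_sim_def intro: mono)
qed

lemma v_square_op_v_class:
  assumes "A \<in> carrier_mat n n" "B \<in> carrier_mat n n" "0 < n"
  shows "v_class n A \<box>\<^sub>v\<^bsub>n\<^esub> v_class n B = v_class n (A \<box>\<^bsub>n\<^esub> B)"
proof -
  have "v_class n (A' \<box>\<^bsub>n\<^esub> B') = v_class n (A \<box>\<^bsub>n\<^esub> B)"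
    if "A' \<in> v_class n A" "B' \<in> v_class n B" for A' B'
  proof -
    have "A \<box>\<^bsub>n\<^esub> B \<sim>\<^bsub>n\<^esub> A' \<box>\<^bsub>n\<^esub> B'"
      using that assms by (intro square_op_cong) (auto simp: mem_v_class)
    then show ?thesis
      by (metis square_op_carrier v_class_eq_iff)
  qed
  then show ?thesis
    using self_mem_v_class[OF assms(1)] self_mem_v_class[OF assms(2)]
    unfolding v_square_op_def by blast
qed

lemma mult_dominates_square_op:
  assumes A: "A \<in> carrier_mat n n" and B: "B \<in> carrier_mat n n" and n: "0 < n"
  shows "A * B \<succeq>\<^bsub>n\<^esub> A \<box>\<^bsub>n\<^esub> B"
proof (rule dominatesI[where m = n and k = n])
  fix v :: "'a vec" assume v: "v \<in> carrier_vec n"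
  let ?N = "of_nat (n * n) :: 'a"
  let ?a = "(max_norm A)\<^sup>2" and ?b = "(max_norm B)\<^sup>2"
  have Bv: "B *\<^sub>v v \<in> carrier_vec n"
    using mult_mat_vec_carrier[OF B v] .
  have "gram_form (A * B) v \<le> ?N * (?a * gram_form B v)"
    using gram_form_le_max_norm[OF A Bv] by (simp add: gram_form_mult[OF A B v] gram_form_def[of B])
  also have "\<dots> \<le> ?N * (?a * (?N * (?b * (v \<bullet> v))))"
    by (intro mult_left_mono gram_form_le_max_norm[OF B v]) auto
  also have "\<dots> = of_nat ((n * n) * (n * n)) * gram_form (A \<box>\<^bsub>n\<^esub> B) v"
    unfolding square_op_def gram_form_smult_one[OF v] power_mult_distrib of_nat_mult[of "n * n"]
    by (simp only: ac_simps)
  finally show "gram_form (A * B) v \<le> of_nat ((n * n) * (n * n)) * gram_form (A \<box>\<^bsub>n\<^esub> B) v" .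
qed (use A B in auto)

section \<open>The natural valuation\<close>

lemma field_val_eqI:
  fixes a b :: "'a::linordered_field"
  assumes r: "\<bar>a\<bar> \<le> of_nat r * \<bar>b\<bar>" and s: "\<bar>b\<bar> \<le> of_nat s * \<bar>a\<bar>"
  shows "field_val a = field_val b"
proof -
  have le: "\<exists>k::nat. \<bar>x\<bar> \<le> of_nat k * \<bar>z\<bar>"
    if "\<bar>x\<bar> \<le> of_nat i * \<bar>y\<bar>" "\<bar>y\<bar> \<le> of_nat j * \<bar>z\<bar>" for x y z :: 'a and i j :: nat
  proof -
    have "\<bar>x\<bar> \<le> of_nat i * (of_nat j * \<bar>z\<bar>)"
      by (rule order_trans[OF that(1) mult_left_mono[OF that(2)]]) simp
    then have "\<bar>x\<bar> \<le> of_nat (i * j) * \<bar>z\<bar>"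
      by (simp add: mult.assoc)
    then show ?thesis by blast
  qed
  have common: "\<exists>k::nat. \<bar>x\<bar> \<le> of_nat k * \<bar>z\<bar> \<and> \<bar>z\<bar> \<le> of_nat k * \<bar>x\<bar>"
    if "\<bar>x\<bar> \<le> of_nat i * \<bar>z\<bar>" "\<bar>z\<bar> \<le> of_nat j * \<bar>x\<bar>" for x z :: 'a and i j :: nat
    using that order_trans[OF that(1) mult_right_mono[of "of_nat i" "of_nat (max i j)"]]
      order_trans[OF that(2) mult_right_mono[of "of_nat j" "of_nat (max i j)"]]
    by (intro exI[of _ "max i j"]) auto
  have "field_val x \<subseteq> field_val y"
    if xy: "\<bar>x\<bar> \<le> of_nat i * \<bar>y\<bar>" "\<bar>y\<bar> \<le> of_nat j * \<bar>x\<bar>" for x y :: 'a and i j :: nat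
  proof
    fix z assume "z \<in> field_val x"
    then obtain k :: nat where "\<bar>x\<bar> \<le> of_nat k * \<bar>z\<bar>" "\<bar>z\<bar> \<le> of_nat k * \<bar>x\<bar>"
      by (auto simp: field_val_def)
    then obtain k1 k2 :: nat where "\<bar>y\<bar> \<le> of_nat k1 * \<bar>z\<bar>" "\<bar>z\<bar> \<le> of_nat k2 * \<bar>y\<bar>"
      using le[OF xy(2)] le[OF _ xy(1)] by blast
    then show "z \<in> field_val y"
      unfolding field_val_def using common by blast
  qed
  then show ?thesis
    using r s by blast
qed

lemma self_mem_field_val: "a \<in> field_val a"
  by (auto simp: field_val_def intro: exI[of _ 1])

lemma field_val_mult_field_val:
  fixes a b :: "'a::linordered_field"
  shows "field_val a \<cdot>\<^sub>F field_val b = field_val (a * b)"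
proof -
  have "field_val (a' * b') = field_val (a * b)" if "a' \<in> field_val a" "b' \<in> field_val b" for a' b'
  proof -
    obtain r :: nat where r: "\<bar>a\<bar> \<le> of_nat r * \<bar>a'\<bar>" "\<bar>a'\<bar> \<le> of_nat r * \<bar>a\<bar>"
      using \<open>a' \<in> field_val a\<close> by (auto simp: field_val_def)
    obtain s :: nat where s: "\<bar>b\<bar> \<le> of_nat s * \<bar>b'\<bar>" "\<bar>b'\<bar> \<le> of_nat s * \<bar>b\<bar>"
      using \<open>b' \<in> field_val b\<close> by (auto simp: field_val_def)
    have "\<bar>a' * b'\<bar> \<le> of_nat (r * s) * \<bar>a * b\<bar>" "\<bar>a * b\<bar> \<le> of_nat (r * s) * \<bar>a' * b'\<bar>"
      using mult_mono[OF r(2) s(2)] mult_mono[OF r(1) s(1)] by (simp_all add: abs_mult ac_simps)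
    then show ?thesis
      by (rule field_val_eqI)
  qed
  then show ?thesis
    using self_mem_field_val unfolding field_val_mult_def by blast
qed

lemma phi_v_class:
  assumes A: "A \<in> carrier_mat n n" and n: "0 < n"
  shows "phi (v_class n A) = field_val (max_norm A)"
proof -
  have "field_val (max_norm B) = field_val (max_norm A)" if "B \<in> v_class n A" for B
  proof -
    have B: "B \<in> carrier_mat n n" and "A \<succeq>\<^bsub>n\<^esub> B" "B \<succeq>\<^bsub>n\<^esub> A"
      using that A by (auto simp: mem_v_class mat_sim_def)
    then obtain r s :: nat
      where "max_norm A \<le> of_nat r * max_norm B" "max_norm B \<le> of_nat s * max_norm A"
      using dominates_imp_max_norm_le[OF _ A n B n n] dominates_imp_max_norm_le[OF _ B n A n n]
      by metis
    then show ?thesis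
      using max_norm_nonneg[OF A n n] max_norm_nonneg[OF B n n] by (intro field_val_eqI) auto
  qed
  then show ?thesis
    using self_mem_v_class[OF A] unfolding phi_def by blast
qed

section \<open>Distributivity\<close>

text \<open>The scalar matrix with scalar \<open>\<parallel>B\<parallel>\<close> lies below \<open>A\<close> and \<open>B\<close>, hence below \<open>E\<close>, while \<open>E\<close> lies
  below \<open>B\<close>. Both ends have norm \<open>\<parallel>B\<parallel>\<close>, so \<open>E\<close> and \<open>B\<close> cannot be told apart by \<open>\<box>\<close>.\<close>

lemma meet_square_op_distrib_le:
  assumes A: "A \<in> carrier_mat n n" and B: "B \<in> carrier_mat n n" and C: "C \<in> carrier_mat n n"
    and E: "E \<in> carrier_mat n n" "E \<sim>\<^bsub>n\<^esub> A @\<^sub>r B" and n: "0 < n"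
    and le: "max_norm A \<le> max_norm B"
  shows "E \<box>\<^bsub>n\<^esub> C \<sim>\<^bsub>n\<^esub> B \<box>\<^bsub>n\<^esub> C" and "A \<box>\<^bsub>n\<^esub> C \<succeq>\<^bsub>n\<^esub> B \<box>\<^bsub>n\<^esub> C"
proof -
  let ?K = "max_norm B \<cdot>\<^sub>m 1\<^sub>m n"
  have C': "C \<in> mats_cols n"
    using carrier_mat_mem_mats_cols[OF C n] .
  have AB: "A @\<^sub>r B \<in> carrier_mat (n + n) n"
    using A B by simp
  have K: "?K \<in> carrier_mat n n" "max_norm ?K = max_norm B"
    using max_norm_nonneg[OF B n n] n by (auto simp: max_norm_smult_one)
  then have KC: "?K \<box>\<^bsub>n\<^esub> C = B \<box>\<^bsub>n\<^esub> C"
    by (simp add: square_op_def)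
  have AK: "A \<succeq>\<^bsub>n\<^esub> ?K" and BK: "B \<succeq>\<^bsub>n\<^esub> ?K"
    using dominates_smult_one[OF A n n le] dominates_smult_one[OF B n n order_refl] .
  have "E \<succeq>\<^bsub>n\<^esub> ?K"
    using E dominates_trans[OF _ append_rows_dominates[OF AK BK A B K(1)] E(1) AB K(1)]
    by (simp add: mat_sim_def)
  moreover have "B \<succeq>\<^bsub>n\<^esub> E"
    using E dominates_trans[OF dominates_append_rows(2)[OF A B] _ B AB E(1)] by (simp add: mat_sim_def)
  ultimately show "E \<box>\<^bsub>n\<^esub> C \<sim>\<^bsub>n\<^esub> B \<box>\<^bsub>n\<^esub> C"
    using square_op_mono_left[OF _ E(1) n K(1) n C' n] square_op_mono_left[OF _ B n E(1) n C' n]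
    unfolding KC mat_sim_def by blast
  show "A \<box>\<^bsub>n\<^esub> C \<succeq>\<^bsub>n\<^esub> B \<box>\<^bsub>n\<^esub> C"
    using square_op_mono_left[OF AK A n K(1) n C' n] unfolding KC .
qed

lemma meet_commute: "x \<sqinter>\<^bsub>L\<^esub> y = y \<sqinter>\<^bsub>L\<^esub> x"
  by (simp add: meet_def insert_commute)

lemma meet_square_op_distrib:
  assumes A: "A \<in> carrier_mat n n" and B: "B \<in> carrier_mat n n" and C: "C \<in> carrier_mat n n"
    and n: "0 < n"
  shows "(v_class n A \<sqinter>\<^bsub>v_poset n\<^esub> v_class n B) \<box>\<^sub>v\<^bsub>n\<^esub> v_class n C =
    (v_class n A \<box>\<^sub>v\<^bsub>n\<^esub> v_class n C) \<sqinter>\<^bsub>v_poset n\<^esub> (v_class n B \<box>\<^sub>v\<^bsub>n\<^esub> v_class n C)"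
proof -
  have ordered: "(v_class n A \<sqinter>\<^bsub>v_poset n\<^esub> v_class n B) \<box>\<^sub>v\<^bsub>n\<^esub> v_class n C =
    (v_class n A \<box>\<^sub>v\<^bsub>n\<^esub> v_class n C) \<sqinter>\<^bsub>v_poset n\<^esub> (v_class n B \<box>\<^sub>v\<^bsub>n\<^esub> v_class n C)"
    if A: "A \<in> carrier_mat n n" and B: "B \<in> carrier_mat n n"
    and le: "max_norm A \<le> max_norm B" for A B
  proof -
    obtain E where E: "E \<in> carrier_mat n n" "E \<sim>\<^bsub>n\<^esub> A @\<^sub>r B"
      and meet: "v_class n A \<sqinter>\<^bsub>v_poset n\<^esub> v_class n B = v_class n E"
      using meet_v_class_append_rows[OF A B] .
    note * = meet_square_op_distrib_le[OF A B C E n le]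
    show ?thesis
      using * meet_v_class_of_dominates[OF _ _ *(2)]
      by (simp add: meet v_square_op_v_class A B C E n v_class_eq_iff)
  qed
  show ?thesis
  proof (cases "max_norm A \<le> max_norm B")
    case True
    then show ?thesis
      by (rule ordered[OF A B])
  next
    case False
    then have "max_norm B \<le> max_norm A"
      by simp
    from ordered[OF B A this] show ?thesis
      by (simp only: meet_commute[of _ "v_class n A"]
          meet_commute[of _ "v_class n A \<box>\<^sub>v\<^bsub>n\<^esub> v_class n C"])
  qed
qed

definition diag_unit :: "nat \<Rightarrow> nat \<Rightarrow> 'a::zero_neq_one mat" where
  "diag_unit n k = mat n n (\<lambda>(i, j). if i = k \<and> j = k then 1 else 0)"

lemma diag_unit_carrier: "diag_unit n k \<in> carrier_mat n n"
  by (simp add: diag_unit_def)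

lemma max_norm_diag_unit: "k < n \<Longrightarrow> max_norm (diag_unit n k :: 'a::linordered_field mat) = 1"
  by (rule max_norm_eqI[where m = n and n = n and i = k and j = k]) (auto simp: diag_unit_def)

lemma zero_mat_dominates:
  assumes B: "B \<in> carrier_mat k n"
  shows "0\<^sub>m m n \<succeq>\<^bsub>n\<^esub> B"
  by (rule dominatesI[where r = 0 and m = m, OF _ B]) (auto simp: gram_form_zero_mat)

text \<open>A matrix that dominates the \<open>k\<close>-th diagonal unit annihilates its kernel, which contains all unit
  vectors except the \<open>k\<close>-th; the \<open>l\<close>-th diagonal unit takes care of the remaining one.\<close>

lemma join_diag_unit:
  assumes "k < n" "l < n" "k \<noteq> l"
  shows "v_class n (diag_unit n k) \<squnion>\<^bsub>v_poset n\<^esub> v_class n (diag_unit n l)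
    = v_class n (0\<^sub>m n n :: 'a::linordered_field mat)"
proof (rule join_v_class_eqI)
  fix D :: "'a mat" assume D: "D \<in> carrier_mat n n"
    and Dk: "D \<succeq>\<^bsub>n\<^esub> diag_unit n k" and Dl: "D \<succeq>\<^bsub>n\<^esub> diag_unit n l"
  have col: "D $$ (i, j) = 0" if ij: "i < n" "j < n" and "j \<noteq> p" and Dp: "D \<succeq>\<^bsub>n\<^esub> diag_unit n p"
    for i j p
  proof -
    obtain r :: nat where r: "\<And>v. v \<in> carrier_vec n \<Longrightarrow>
        gram_form D v \<le> of_nat r * gram_form (diag_unit n p) v"
      using dominatesE[OF Dp D diag_unit_carrier] by blast
    have "gram_form (diag_unit n p :: 'a mat) (unit_vec n j) = 0"
      unfolding gram_form_unit_vec[OF diag_unit_carrier ij(2)]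
      using ij \<open>j \<noteq> p\<close> by (intro sum.neutral) (auto simp: diag_unit_def)
    then have "(\<Sum>i<n. (D $$ (i, j))\<^sup>2) \<le> 0"
      using r[of "unit_vec n j"] gram_form_unit_vec[OF D ij(2)] by simp
    moreover have "(D $$ (i, j))\<^sup>2 \<le> (\<Sum>i<n. (D $$ (i, j))\<^sup>2)"
      using ij by (intro member_le_sum) auto
    ultimately show ?thesis
      by (metis order_trans power2_less_eq_zero_iff)
  qed
  have "D = 0\<^sub>m n n"
    using D col[OF _ _ _ Dk] col[OF _ _ _ Dl] \<open>k \<noteq> l\<close> by (intro eq_matI) (metis index_zero_mat, auto)
  then show "D \<succeq>\<^bsub>n\<^esub> 0\<^sub>m n n"
    using dominates_refl[OF D] by simp
qed (auto intro: zero_mat_dominates diag_unit_carrier)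

lemma join_v_class_self:
  assumes "A \<in> carrier_mat n n"
  shows "v_class n A \<squnion>\<^bsub>v_poset n\<^esub> v_class n A = v_class n A"
  using assms by (intro join_v_class_eqI) (auto intro: dominates_refl)

lemma join_square_op_not_distrib:
  assumes n: "2 \<le> n"
  shows "\<exists>A\<in>carrier_mat n n. \<exists>B\<in>carrier_mat n n. \<exists>C\<in>carrier_mat n n.
    (v_class n A \<squnion>\<^bsub>v_poset n\<^esub> v_class n B) \<box>\<^sub>v\<^bsub>n\<^esub> v_class n (C :: 'a::linordered_field mat) \<noteq>
    (v_class n A \<box>\<^sub>v\<^bsub>n\<^esub> v_class n C) \<squnion>\<^bsub>v_poset n\<^esub> (v_class n B \<box>\<^sub>v\<^bsub>n\<^esub> v_class n C)"
proof -
  \<comment> \<open>The scalar \<open>1\<close> is kept explicit so that \<open>?I\<close> has the shape of a value of \<open>\<box>\<close>.\<close>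
  let ?A = "diag_unit n 0 :: 'a mat" and ?B = "diag_unit n 1 :: 'a mat"
  let ?I = "1 \<cdot>\<^sub>m 1\<^sub>m n :: 'a mat" and ?Z = "0\<^sub>m n n :: 'a mat"
  have pos: "0 < n" "1 < n"
    using n by auto
  have I: "?I \<in> carrier_mat n n"
    by simp
  have sq: "?A \<box>\<^bsub>n\<^esub> ?I = ?I" "?B \<box>\<^bsub>n\<^esub> ?I = ?I"
    unfolding square_op_def max_norm_diag_unit[OF pos(1)] max_norm_diag_unit[OF pos(2)]
      max_norm_smult_one[OF pos(1)] by simp_all
  have "max_norm ?Z = 0"
    using pos by (intro max_norm_eqI[where m = n and n = n and i = 0 and j = 0]) auto
  then have sqZ: "?Z \<box>\<^bsub>n\<^esub> ?I = 0 \<cdot>\<^sub>m 1\<^sub>m n"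
    by (simp add: square_op_def)
  have "\<not> ?I \<succeq>\<^bsub>n\<^esub> 0 \<cdot>\<^sub>m 1\<^sub>m n"
  proof
    assume "?I \<succeq>\<^bsub>n\<^esub> 0 \<cdot>\<^sub>m 1\<^sub>m n"
    then obtain r :: nat where "max_norm ?I \<le> of_nat r * max_norm (0 \<cdot>\<^sub>m 1\<^sub>m n :: 'a mat)"
      using pos by (elim dominates_imp_max_norm_le[where m = n and k = n]) auto
    then show False
      unfolding max_norm_smult_one[OF pos(1)] by simp
  qed
  then have "v_class n (0 \<cdot>\<^sub>m 1\<^sub>m n) \<noteq> v_class n ?I"
    by (subst v_class_eq_iff) (auto simp: mat_sim_def)
  moreover have "(v_class n ?A \<squnion>\<^bsub>v_poset n\<^esub> v_class n ?B) \<box>\<^sub>v\<^bsub>n\<^esub> v_class n ?I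
      = v_class n (0 \<cdot>\<^sub>m 1\<^sub>m n)"
    using pos unfolding join_diag_unit[OF pos zero_neq_one]
    by (subst v_square_op_v_class) (auto simp: sqZ)
  moreover have "(v_class n ?A \<box>\<^sub>v\<^bsub>n\<^esub> v_class n ?I) \<squnion>\<^bsub>v_poset n\<^esub> (v_class n ?B \<box>\<^sub>v\<^bsub>n\<^esub> v_class n ?I)
      = v_class n ?I"
    unfolding v_square_op_v_class[OF diag_unit_carrier I pos(1)] sq
    by (rule join_v_class_self[OF I])
  ultimately have "(v_class n ?A \<squnion>\<^bsub>v_poset n\<^esub> v_class n ?B) \<box>\<^sub>v\<^bsub>n\<^esub> v_class n ?I \<noteq>
    (v_class n ?A \<box>\<^sub>v\<^bsub>n\<^esub> v_class n ?I) \<squnion>\<^bsub>v_poset n\<^esub> (v_class n ?B \<box>\<^sub>v\<^bsub>n\<^esub> v_class n ?I)"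
    by simp
  then show ?thesis
    using diag_unit_carrier I by blast
qed

theorem proposition7p1:
  fixes n :: nat and M :: "'a::linordered_field mat set"
  assumes "n > 0" and "M = carrier_mat n n"
  shows "((\<forall>A\<in>M. \<forall>B\<in>M. \<forall>C\<in>M. (A \<box>\<^bsub>n\<^esub> B) \<box>\<^bsub>n\<^esub> C = A \<box>\<^bsub>n\<^esub> (B \<box>\<^bsub>n\<^esub> C)) \<and>
     (\<forall>A\<in>M. \<forall>B\<in>M. A \<box>\<^bsub>n\<^esub> B = B \<box>\<^bsub>n\<^esub> A)) \<and>
   ((\<forall>A\<in>M. \<forall>B\<in>M. A \<succeq>\<^bsub>n\<^esub> B \<longrightarrow>
        (\<forall>C\<in>mats_cols n. A \<box>\<^bsub>n\<^esub> C \<succeq>\<^bsub>n\<^esub> B \<box>\<^bsub>n\<^esub> C)) \<and>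
     equiv M (sim_rel n) \<and>
     (\<forall>A\<in>M. \<forall>A'\<in>M. \<forall>B\<in>M. \<forall>B'\<in>M.
        A \<sim>\<^bsub>n\<^esub> A' \<longrightarrow> B \<sim>\<^bsub>n\<^esub> B' \<longrightarrow> A \<box>\<^bsub>n\<^esub> B \<sim>\<^bsub>n\<^esub> A' \<box>\<^bsub>n\<^esub> B')) \<and>
   (\<forall>A\<in>M. \<forall>B\<in>M. v_class n A \<box>\<^sub>v\<^bsub>n\<^esub> v_class n B \<sqsubseteq>\<^bsub>v_poset n\<^esub> v_class n (A * B)) \<and>
   (\<forall>A\<in>M. \<forall>B\<in>M. phi (v_class n A \<box>\<^sub>v\<^bsub>n\<^esub> v_class n B) = phi (v_class n A) \<cdot>\<^sub>F phi (v_class n B)) \<and>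
   (\<forall>A\<in>M. \<forall>B\<in>M. \<forall>C\<in>M.
       (v_class n A \<sqinter>\<^bsub>v_poset n\<^esub> v_class n B) \<box>\<^sub>v\<^bsub>n\<^esub> v_class n C =
       (v_class n A \<box>\<^sub>v\<^bsub>n\<^esub> v_class n C) \<sqinter>\<^bsub>v_poset n\<^esub> (v_class n B \<box>\<^sub>v\<^bsub>n\<^esub> v_class n C)) \<and>
   (n \<ge> 2 \<longrightarrow> \<not> (\<forall>A\<in>M. \<forall>B\<in>M. \<forall>C\<in>M.
       (v_class n A \<squnion>\<^bsub>v_poset n\<^esub> v_class n B) \<box>\<^sub>v\<^bsub>n\<^esub> v_class n C =
       (v_class n A \<box>\<^sub>v\<^bsub>n\<^esub> v_class n C) \<squnion>\<^bsub>v_poset n\<^esub> (v_class n B \<box>\<^sub>v\<^bsub>n\<^esub> v_class n C)))"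
proof -
  have n: "0 < n" and M: "M = carrier_mat n n"
    by fact+
  have multiplicative: "phi (v_class n A \<box>\<^sub>v\<^bsub>n\<^esub> v_class n B) = phi (v_class n A) \<cdot>\<^sub>F phi (v_class n B)"
    if "A \<in> M" "B \<in> M" for A B
    using that n unfolding M
    by (simp add: v_square_op_v_class phi_v_class max_norm_square_op[where m = n and k = n]
        field_val_mult_field_val)
  have surmultiplicative:
    "v_class n A \<box>\<^sub>v\<^bsub>n\<^esub> v_class n B \<sqsubseteq>\<^bsub>v_poset n\<^esub> v_class n (A * B)" if "A \<in> M" "B \<in> M" for A B
    using that n mult_dominates_square_op unfolding M
    by (simp add: v_square_op_v_class v_class_le_iff)
  show ?thesis
    unfolding M
  proof (intro conjI ballI impI)
    show "equiv (carrier_mat n n) (sim_rel n :: 'a mat rel)"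
      by (rule equiv_sim_rel)
  next
    fix A B C :: "'a mat"
    assume "A \<in> carrier_mat n n" "B \<in> carrier_mat n n" "A \<succeq>\<^bsub>n\<^esub> B" "C \<in> mats_cols n"
    then show "A \<box>\<^bsub>n\<^esub> C \<succeq>\<^bsub>n\<^esub> B \<box>\<^bsub>n\<^esub> C"
      using square_op_mono_left[of A n B n n C] n by simp
  next
    assume "2 \<le> n"
    from join_square_op_not_distrib[OF this, where 'a = 'a]
    show "\<not> (\<forall>A\<in>carrier_mat n n. \<forall>B\<in>carrier_mat n n. \<forall>C\<in>carrier_mat n n.
        (v_class n A \<squnion>\<^bsub>v_poset n\<^esub> v_class n B) \<box>\<^sub>v\<^bsub>n\<^esub> v_class n (C :: 'a mat) =
        (v_class n A \<box>\<^sub>v\<^bsub>n\<^esub> v_class n C) \<squnion>\<^bsub>v_poset n\<^esub> (v_class n B \<box>\<^sub>v\<^bsub>n\<^esub> v_class n C))"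
      by blast
  qed (use n square_op_commute in \<open>auto simp: M multiplicative surmultiplicative
      meet_square_op_distrib intro: square_op_assoc square_op_cong\<close>)
qed

end
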